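(* Let $n\ge 2$ and let $A\in\mathbb{C}^{n\times n}$. Let $\mathcal{M}\subset\mathbb{C}^{n\times n}$ be the set of matrices having multiple eigenvalues and let $\mathcal{D}\subset\mathcal{M}$ be the set of defective matrices. There exists a matrix in $\mathcal{D}$ nearest to $A$ (that is, a matrix $B\in\mathcal{D}$ with $\|A-B\|_F=\inf_{Y\in\mathcal{D}}\|A-Y\|_F$) if and only if $A\notin\mathcal{M}\setminus\mathcal{D}$.
   Context: A matrix has multiple eigenvalues if at least one of its eigenvalues has algebraic multiplicity at least $2$. A square matrix is defective if it has at least one eigenvalue whose algebraic multiplicity is strictly larger than its geometric multiplicity. Distances are measured in the Frobenius norm $\|\cdot\|_F$. *)

theory Defs
  imports
    Complex_Main
    "Jordan_Normal_Form.Char_Poly"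
    "Jordan_Normal_Form.Matrix_Kernel"
begin

definition frobenius_norm :: "complex mat \<Rightarrow> real" where
  "frobenius_norm A =
     sqrt (\<Sum>i<dim_row A. \<Sum>j<dim_col A. (cmod (A $$ (i, j)))\<^sup>2)"

definition algebraic_multiplicity :: "complex mat \<Rightarrow> complex \<Rightarrow> nat" where
  "algebraic_multiplicity A \<mu> = Polynomial.order \<mu> (char_poly A)"

(* char_matrix A e is A - e I, so its kernel is the eigenspace of e. *)
definition geometric_multiplicity :: "complex mat \<Rightarrow> complex \<Rightarrow> nat" where
  "geometric_multiplicity A \<mu> = kernel_dim (char_matrix A \<mu>)"

definition has_multiple_eigenvalues :: "complex mat \<Rightarrow> bool" where
  "has_multiple_eigenvalues A \<longleftrightarrow>
     (\<exists>\<mu>. eigenvalue A \<mu> \<and> algebraic_multiplicity A \<mu> \<ge> 2)"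

definition defective :: "complex mat \<Rightarrow> bool" where
  "defective A \<longleftrightarrow>
     (\<exists>\<mu>. eigenvalue A \<mu> \<and> algebraic_multiplicity A \<mu> > geometric_multiplicity A \<mu>)"

definition multiple_eigenvalue_matrices :: "nat \<Rightarrow> complex mat set" where
  "multiple_eigenvalue_matrices n = {A \<in> carrier_mat n n. has_multiple_eigenvalues A}"

definition defective_matrices :: "nat \<Rightarrow> complex mat set" where
  "defective_matrices n = {A \<in> carrier_mat n n. defective A}"

lemma geometric_multiplicity_pos:
  assumes A: "A \<in> carrier_mat n n" and ev: "eigenvalue A \<mu>"
  shows "geometric_multiplicity A \<mu> > 0"
proof (rule ccontr)
  let ?C = "char_matrix A \<mu>"
  assume "\<not> ?thesis"
  then have 0: "kernel_dim ?C = 0" by (simp add: geometric_multiplicity_def)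
  have C: "?C \<in> carrier_mat n n" using A by simp
  interpret K: kernel n n ?C by unfold_locales (rule C)
  obtain B where fin: "finite B" and B: "K.basis B"
    using kernel_basis_exists[OF C] by blast
  have "card B = 0" using K.Ker.dim_basis[OF fin B] 0 by simp
  then have "B = {}" using fin by simp
  then have ker: "mat_kernel ?C = {0\<^sub>v n}"
    using B unfolding K.Ker.basis_def by (simp add: K.Ker.span_empty)
  obtain v where "eigenvector A v \<mu>" using ev unfolding eigenvalue_def by blast
  then have "v \<in> mat_kernel ?C" "v \<noteq> 0\<^sub>v n"
    using eigenvector_char_matrix[OF A] mat_kernelI[OF C] by auto
  then show False using ker by simp
qed

lemma defective_matrices_subset:
  "defective_matrices n \<subseteq> multiple_eigenvalue_matrices n"
proof
  fix A assume "A \<in> defective_matrices n"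
  then obtain \<mu> where A: "A \<in> carrier_mat n n" and ev: "eigenvalue A \<mu>"
    and "algebraic_multiplicity A \<mu> > geometric_multiplicity A \<mu>"
    unfolding defective_matrices_def defective_def by blast
  with geometric_multiplicity_pos[OF A ev] have "algebraic_multiplicity A \<mu> \<ge> 2"
    by linarith
  with A ev show "A \<in> multiple_eigenvalue_matrices n"
    unfolding multiple_eigenvalue_matrices_def has_multiple_eigenvalues_def by blast
qed

end

theory Submission
  imports
    "HOL-Analysis.Topology_Euclidean_Space"
    "Jordan_Normal_Form.Jordan_Normal_Form_Existence"
    "Jordan_Normal_Form.Jordan_Normal_Form_Uniqueness"
    Defs
begin

text \<open>
  The set of matrices with multiple eigenvalues is closed, so \<open>A\<close> has a nearest matrix \<open>B\<close> in it.
  If \<open>B\<close> is not defective, then it is diagonalizable, \<open>B = S L S\<^sup>-\<^sup>1\<close> with \<open>L\<close> diagonal and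
  \<open>L\<^sub>a\<^sub>a = L\<^sub>b\<^sub>b\<close> for some \<open>a \<noteq> b\<close>. Every line \<open>B + t S F S\<^sup>-\<^sup>1\<close> along which \<open>L + t F\<close> is triangular with
  equal entries at \<open>a\<close> and \<open>b\<close> stays in the set, so \<open>A - B\<close> is orthogonal to its direction. The directions obtained from all
  diagonalizations of \<open>B\<close> together span the whole matrix space, hence \<open>A = B\<close>.
  Conversely, if \<open>A\<close> is a nondefective matrix \<open>S L S\<^sup>-\<^sup>1\<close> with \<open>L\<^sub>a\<^sub>a = L\<^sub>b\<^sub>b\<close>, then adding a small
  entry at position \<open>(a, b)\<close> of \<open>L\<close> gives a defective matrix, so the infimum is \<open>0\<close>
  and not attained.
\<close>

unbundle no vec_syntax

section \<open>Multiple eigenvalues as multiple roots of the characteristic polynomial\<close>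

lemma char_poly_nonzero:
  fixes A :: "complex mat"
  assumes "A \<in> carrier_mat n n"
  shows "char_poly A \<noteq> 0"
  using degree_monic_char_poly[OF assms] by auto

lemma multiple_eigenvalue_matrices_iff:
  assumes A: "A \<in> carrier_mat n n"
  shows "A \<in> multiple_eigenvalue_matrices n \<longleftrightarrow> (\<exists>\<mu>. Polynomial.order \<mu> (char_poly A) \<ge> 2)"
proof -
  have "eigenvalue A \<mu>" if "Polynomial.order \<mu> (char_poly A) \<ge> 2" for \<mu>
    using that char_poly_nonzero[OF A] order_root[of "char_poly A" \<mu>]
    by (auto simp: eigenvalue_root_char_poly[OF A])
  then show ?thesis
    using A unfolding multiple_eigenvalue_matrices_def has_multiple_eigenvalues_def
      algebraic_multiplicity_def by blast
qed

lemma order_prod_list_linear: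
  fixes a :: complex
  shows "Polynomial.order a (\<Prod>b\<leftarrow>bs. [:- b, 1:]) = count_list bs a"
proof (induction bs)
  case (Cons b bs)
  have "(\<Prod>c\<leftarrow>bs. [:- c, 1:]) \<noteq> 0"
    by (auto simp: prod_list_zero_iff)
  then have "[:- b, 1:] * (\<Prod>c\<leftarrow>bs. [:- c, 1:]) \<noteq> 0"
    by (simp only: mult_eq_0_iff) simp
  from order_mult[OF this, of a] show ?case
    using Cons by (simp add: order_linear' del: mult_pCons_left)
qed simp

lemma two_le_count_list_iff:
  "2 \<le> count_list xs x \<longleftrightarrow>
    (\<exists>i j. i < length xs \<and> j < length xs \<and> i \<noteq> j \<and> xs ! i = x \<and> xs ! j = x)"
proof -
  have "2 \<le> card S \<longleftrightarrow> (\<exists>i\<in>S. \<exists>j\<in>S. i \<noteq> j)" if "finite S" for S :: "nat set"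
    using that card_le_Suc0_iff_eq[of S] by (auto simp: not_less_eq_eq[symmetric] numeral_2_eq_2)
  from this[of "{i. i < length xs \<and> xs ! i = x}"]
  have "2 \<le> card {i. i < length xs \<and> xs ! i = x} \<longleftrightarrow> 
      (\<exists>i j. i < length xs \<and> j < length xs \<and> i \<noteq> j \<and> xs ! i = x \<and> xs ! j = x)"
    by auto
  moreover have "count_list xs x = card {i. i < length xs \<and> xs ! i = x}"
    by (simp add: count_list_eq_length_filter length_filter_conv_card eq_commute[of x])
  ultimately show ?thesis
    by simp
qed

lemma two_le_order_upper_triangular:
  fixes L :: "complex mat"
  assumes L: "L \<in> carrier_mat n n" and ut: "upper_triangular L"
  shows "2 \<le> Polynomial.order \<mu> (char_poly L) \<longleftrightarrow>
    (\<exists>i j. i < n \<and> j < n \<and> i \<noteq> j \<and> L $$ (i, i) = \<mu> \<and> L $$ (j, j) = \<mu>)"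
  unfolding char_poly_upper_triangular[OF L ut] order_prod_list_linear two_le_count_list_iff
  using L by (auto simp: diag_mat_def intro!: ex_cong1 conj_cong)

text \<open>Transposition keeps the characteristic polynomial and the diagonal, so the lower
  triangular case reduces to the upper one. Both shapes occur later, because a perturbation at
  position \<open>(i, j)\<close> may lie on either side of the diagonal.\<close>

lemma similar_triangular_multiple:
  assumes A: "A \<in> carrier_mat n n" and sim: "similar_mat A L"
    and ut: "upper_triangular L \<or> upper_triangular (transpose_mat L)"
    and ij: "i < n" "j < n" "i \<noteq> j" and eq: "L $$ (i, i) = L $$ (j, j)"
  shows "A \<in> multiple_eigenvalue_matrices n"
proof -
  have L: "L \<in> carrier_mat n n"
    using similar_matD[OF sim] A by auto
  have "2 \<le> Polynomial.order (L $$ (i, i)) (char_poly L)"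
    using ut
  proof
    assume "upper_triangular L"
    then show ?thesis
      using two_le_order_upper_triangular[OF L] ij eq by metis
  next
    assume "upper_triangular (transpose_mat L)"
    moreover have "transpose_mat L \<in> carrier_mat n n"
      "transpose_mat L $$ (i, i) = L $$ (i, i)" "transpose_mat L $$ (j, j) = L $$ (i, i)"
      using L ij eq by simp_all
    ultimately show ?thesis
      using two_le_order_upper_triangular ij char_poly_transpose_mat[OF L] by metis
  qed
  then show ?thesis
    unfolding multiple_eigenvalue_matrices_iff[OF A] char_poly_similar[OF sim] by blast
qed

lemma similar_diagonal_multiple:
  assumes BM: "B \<in> multiple_eigenvalue_matrices n"
    and wit: "similar_mat_wit B L S T" and diag: "diagonal_mat L"
  obtains a b where "a < n" "b < n" "a \<noteq> b" "L $$ (a, a) = L $$ (b, b)"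
proof -
  have B: "B \<in> carrier_mat n n"
    using BM unfolding multiple_eigenvalue_matrices_def by blast
  note L = similar_mat_witD2(5)[OF B wit]
  have "upper_triangular L"
    using diag L unfolding diagonal_mat_def by auto
  moreover have "char_poly B = char_poly L"
    using wit by (intro char_poly_similar) (auto simp: similar_mat_def)
  ultimately show ?thesis
    using that BM multiple_eigenvalue_matrices_iff[OF B] two_le_order_upper_triangular[OF L] by metis
qed

section \<open>Diagonalizability of nondefective matrices\<close>

lemma jordan_matrix_diagonal:
  assumes "\<And>na. na \<in> set n_as \<Longrightarrow> fst na = 1"
  shows "diagonal_mat (jordan_matrix n_as :: 'a :: comm_ring_1 mat)"
  using assms
proof (induction n_as)
  case Nil
  then show ?case
    by (simp add: diagonal_mat_def jordan_matrix_def)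
next
  case (Cons na n_as)
  obtain a where na: "na = (1, a)"
    using Cons.prems[of na] by (cases na) auto
  have IH: "diagonal_mat (jordan_matrix n_as :: 'a mat)"
    using Cons by simp
  have "jordan_matrix (na # n_as) = four_block_mat (jordan_block 1 a)
      (0\<^sub>m 1 (sum_list (map fst n_as))) (0\<^sub>m (sum_list (map fst n_as)) 1) (jordan_matrix n_as)"
    unfolding na using jordan_matrix_dim[of n_as]
    by (simp add: jordan_matrix_def Let_def)
  then show ?case
    using IH unfolding diagonal_mat_def by auto
qed

text \<open>Since \<open>min 1 m \<le> m\<close> termwise, the reverse inequality of the sums leaves
  no slack in any term. For the Jordan block sizes of one eigenvalue, the two sums are its algebraic
  and geometric multiplicities.\<close>

lemma sum_list_min_one_eq:
  fixes ns :: "nat list"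
  assumes "sum_list ns \<le> sum_list (map (min 1) ns)" "n \<in> set ns"
  shows "n \<le> 1"
proof -
  have "sum_list (map (min 1) ms) \<le> sum_list ms" for ms :: "nat list"
    by (induction ms) auto
  with assms show ?thesis
  proof (induction ns)
    case (Cons m ns)
    have *: "sum_list (map (min 1) ns) \<le> sum_list ns"
      by (rule Cons.prems(3))
    have "m \<le> 1"
      using Cons.prems(1) * by simp
    moreover have "sum_list ns \<le> sum_list (map (min 1) ns)"
      using Cons.prems(1) by simp
    ultimately show ?case
      using Cons.IH Cons.prems(2,3) by auto
  qed simp
qed

text \<open>The algebraic multiplicity adds the sizes of the Jordan blocks of an eigenvalue, while
  the geometric multiplicity counts these blocks. If the former never exceeds the latter, all blocks
  have size 1.\<close>

lemma nondefective_diagonalizable: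
  assumes B: "B \<in> carrier_mat n n" and nd: "\<not> defective B"
  obtains L S T where "similar_mat_wit B L S T" "diagonal_mat L"
proof -
  obtain as where "char_poly B = (\<Prod>a\<leftarrow>as. [:- a, 1:])"
    using char_poly_factorized[OF B] by blast
  then obtain n_as where jnf: "jordan_nf B n_as"
    using jordan_nf_exists[OF B] by blast
  have "fst na = 1" if na: "na \<in> set n_as" for na
  proof -
    let ?bs = "map fst (filter (\<lambda>nb. snd nb = snd na) n_as)"
    have mem: "fst na \<in> set ?bs"
      using na by auto
    \<comment> \<open>\<open>jordan_nf\<close> admits no blocks of size 0. Hence
      \<open>snd na\<close> is a genuine eigenvalue, and the bound \<open>fst na \<le> 1\<close>
      obtained below pins the size to 1.\<close>
    have pos: "fst na \<noteq> 0"
      using jnf na unfolding jordan_nf_def by force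
    have alg: "algebraic_multiplicity B (snd na) = sum_list ?bs"
      unfolding algebraic_multiplicity_def by (rule jordan_nf_order[OF jnf])
    have "geometric_multiplicity B (snd na) = dim_gen_eigenspace B (snd na) 1"
      using B unfolding geometric_multiplicity_def dim_gen_eigenspace_def by simp
    also have "\<dots> = sum_list (map (min 1) ?bs)"
      using dim_gen_eigenspace[OF jnf, of "snd na" 1]
      by (simp add: case_prod_beta' comp_def)
    finally have geo: "geometric_multiplicity B (snd na) = sum_list (map (min 1) ?bs)" .
    have "sum_list ?bs \<noteq> 0"
      using mem pos by (metis sum_list_eq_0_iff)
    then have "eigenvalue B (snd na)"
      using alg order_root[of "char_poly B" "snd na"] 
      unfolding algebraic_multiplicity_def eigenvalue_root_char_poly[OF B] by auto
    then have "sum_list ?bs \<le> sum_list (map (min 1) ?bs)"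
      using nd alg geo unfolding defective_def by (metis not_less)
    from sum_list_min_one_eq[OF this mem] pos show ?thesis
      by simp
  qed
  then have "diagonal_mat (jordan_matrix n_as :: complex mat)"
    by (intro jordan_matrix_diagonal)
  moreover obtain S T where "similar_mat_wit B (jordan_matrix n_as) S T"
    using jnf unfolding jordan_nf_def similar_mat_def by blast
  ultimately show ?thesis
    using that by blast
qed

section \<open>Existence of a nearest matrix with a multiple eigenvalue\<close>

text \<open>Bolzano-Weierstrass, one index at a time: each new index refines the subsequence found
  so far, and the refinement keeps the earlier limits.\<close>

lemma finite_family_convergent_subsequence:
  fixes x :: "'i \<Rightarrow> nat \<Rightarrow> complex"
  assumes "finite I" "\<And>i. i \<in> I \<Longrightarrow> bounded (range (x i))"
  obtains r l where "strict_mono r" "\<And>i. i \<in> I \<Longrightarrow> (\<lambda>k. x i (r k)) \<longlonglongrightarrow> l i"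
proof -
  have "\<exists>r l. strict_mono r \<and> (\<forall>i\<in>I. (\<lambda>k. x i (r k)) \<longlonglongrightarrow> l i)"
    using assms
  proof (induction I rule: finite_induct)
    case empty
    then show ?case
      by (auto intro: exI[of _ id] strict_mono_id)
  next
    case (insert j J)
    then obtain r l where r: "strict_mono r" and l: "\<And>i. i \<in> J \<Longrightarrow> (\<lambda>k. x i (r k)) \<longlonglongrightarrow> l i"
      by auto
    have "bounded (range (x j \<circ> r))"
      using insert.prems[of j] by (auto intro: bounded_subset)
    then obtain m q where q: "strict_mono q" and m: "((x j \<circ> r) \<circ> q) \<longlonglongrightarrow> m"
      using bounded_imp_convergent_subsequence by blast
    have "(\<lambda>k. x i ((r \<circ> q) k)) \<longlonglongrightarrow> (l(j := m)) i" if "i \<in> insert j J" for i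
    proof (cases "i = j")
      case True
      then show ?thesis
        using m by (simp add: comp_def)
    next
      case False
      then show ?thesis
        using LIMSEQ_subseq_LIMSEQ[OF l q, of i] that by (simp add: comp_def)
    qed
    then show ?case
      using strict_mono_o[OF r q] by blast
  qed
  then show ?thesis
    using that by blast
qed

text \<open>By the Leibniz formula for the determinant, the value is a polynomial in the matrix
  entries and the evaluation point, hence jointly continuous in them.\<close>

lemma poly_char_poly_tendsto:
  fixes Y :: "nat \<Rightarrow> complex mat"
  assumes Y: "\<And>k. Y k \<in> carrier_mat n n" and B: "B \<in> carrier_mat n n"
    and lim: "\<And>i j. i < n \<Longrightarrow> j < n \<Longrightarrow> (\<lambda>k. Y k $$ (i, j)) \<longlonglongrightarrow> B $$ (i, j)"
    and z: "z \<longlonglongrightarrow> w"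
  shows "(\<lambda>k. poly (char_poly (Y k)) (z k)) \<longlonglongrightarrow> poly (char_poly B) w"
proof -
  have eq: "poly (char_poly C) u = (\<Sum>p\<in>{p. p permutes {0..<n}}. signof p *
      (\<Prod>i = 0..<n. (if i = p i then u else 0) - C $$ (i, p i)))"
    if C: "C \<in> carrier_mat n n" for C :: "complex mat" and u
  proof -
    have D: "- char_matrix C u \<in> carrier_mat n n"
      using C by simp
    show ?thesis
      unfolding char_poly_matrix[OF C] det_def'[OF D]
      using C by (intro sum.cong refl arg_cong2[where f = "(*)"] prod.cong)
        (auto simp: char_matrix_def dest: permutes_in_image)
  qed
  have "(\<lambda>k. (if i = p i then z k else 0) - Y k $$ (i, p i))
      \<longlonglongrightarrow> (if i = p i then w else 0) - B $$ (i, p i)"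
    if "p permutes {0..<n}" "i \<in> {0..<n}" for p i
  proof -
    have "i < n" "p i < n"
      using that permutes_in_image[of p "{0..<n}" i] by auto
    then show ?thesis
      using lim z by (auto intro!: tendsto_intros)
  qed
  then show ?thesis
    unfolding eq[OF Y] eq[OF B] by (auto intro!: tendsto_sum tendsto_mult tendsto_prod)
qed

text \<open>Over the complex numbers, differentiation lowers the order of a root by exactly one.
  Unlike the order, the two equations can be passed to a limit.\<close>

lemma two_le_order_iff:
  fixes p :: "complex poly"
  assumes "degree p > 0"
  shows "2 \<le> Polynomial.order a p \<longleftrightarrow> poly p a = 0 \<and> poly (pderiv p) a = 0"
proof -
  have p: "p \<noteq> 0" "pderiv p \<noteq> 0"
    using assms by (auto simp: pderiv_eq_0_iff)
  show ?thesis
  proof (cases "poly p a = 0")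
    case True
    then have "Polynomial.order a p = Suc (Polynomial.order a (pderiv p))"
      using p order_root[of p a] by (intro order_pderiv) auto
    then show ?thesis
      using True p order_root[of "pderiv p" a] by auto
  next
    case False
    then show ?thesis
      using order_root[of p a] by auto
  qed
qed

text \<open>The derivative of the characteristic polynomial is the sum of the characteristic
  polynomials of the submatrices obtained by deleting row and column \<open>i\<close>. Both
  equations are thus covered by continuity of characteristic polynomials.\<close>

lemma multiple_eigenvalue_iff_common_root:
  fixes A :: "complex mat"
  assumes A: "A \<in> carrier_mat n n" and n: "n > 0"
  shows "2 \<le> Polynomial.order \<mu> (char_poly A) \<longleftrightarrow>
    poly (char_poly A) \<mu> = 0 \<and> (\<Sum>i<n. poly (char_poly (mat_delete A i i)) \<mu>) = 0"
proof -
  have "degree (char_poly A) > 0"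
    using degree_monic_char_poly[OF A] n by simp
  from two_le_order_iff[OF this] show ?thesis
    by (simp add: pderiv_char_poly[OF A] poly_sum)
qed

text \<open>Reading the eigenvector equation in a row where the eigenvector has an entry of maximal
  modulus \<open>m\<close>, and dividing by \<open>m\<close>, bounds the eigenvalue by the absolute
  sum of that row. The bound keeps eigenvalues bounded along a sequence of matrices with bounded
  entries.\<close>

lemma eigenvalue_norm_le:
  assumes A: "A \<in> carrier_mat n n" and ev: "eigenvalue A \<mu>"
  shows "cmod \<mu> \<le> (\<Sum>i<n. \<Sum>j<n. cmod (A $$ (i, j)))"
proof -
  obtain v where v: "v \<in> carrier_vec n" "v \<noteq> 0\<^sub>v n" and Av: "A *\<^sub>v v = \<mu> \<cdot>\<^sub>v v"
    using ev A unfolding eigenvalue_def eigenvector_def by auto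
  have ne: "{..<n} \<noteq> {}"
    using eigenvalue_imp_nonzero_dim[OF A ev] by auto
  define m where "m = Max ((\<lambda>i. cmod (v $ i)) ` {..<n})"
  have le: "cmod (v $ j) \<le> m" if "j < n" for j
    unfolding m_def using that by auto
  have "m \<in> (\<lambda>i. cmod (v $ i)) ` {..<n}"
    unfolding m_def using ne by (intro Max_in) auto
  then obtain i where i: "i < n" "m = cmod (v $ i)"
    by auto
  have "m > 0"
  proof (rule ccontr)
    assume "\<not> m > 0"
    then have "v $ j = 0" if "j < n" for j
      using le[OF that] norm_ge_zero[of "v $ j"] by (smt (verit) norm_le_zero_iff)
    then have "v = 0\<^sub>v n"
      using v(1) by (intro eq_vecI) auto
    with v(2) show False
      by simp
  qed
  have "\<mu> * v $ i = (\<Sum>j<n. A $$ (i, j) * v $ j)"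
    using arg_cong[OF Av, of "\<lambda>w. w $ i"] A v(1) i(1)
    by (simp add: scalar_prod_def atLeast0LessThan)
  then have "cmod \<mu> * m \<le> (\<Sum>j<n. cmod (A $$ (i, j)) * cmod (v $ j))"
    unfolding i(2) by (metis (mono_tags, lifting) norm_mult norm_sum sum.cong)
  also have "\<dots> \<le> (\<Sum>j<n. cmod (A $$ (i, j)) * m)"
    using le by (intro sum_mono mult_left_mono) auto
  also have "\<dots> = (\<Sum>j<n. cmod (A $$ (i, j))) * m"
    by (simp add: sum_distrib_right)
  finally have "cmod \<mu> \<le> (\<Sum>j<n. cmod (A $$ (i, j)))"
    using \<open>m > 0\<close> by simp
  also have "\<dots> \<le> (\<Sum>i<n. \<Sum>j<n. cmod (A $$ (i, j)))"
    using i(1) by (intro member_le_sum[of i "{..<n}" "\<lambda>i. \<Sum>j<n. cmod (A $$ (i, j))"]) 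
      (auto intro: sum_nonneg)
  finally show ?thesis .
qed

lemma frobenius_norm_carrier:
  assumes "A \<in> carrier_mat n n"
  shows "frobenius_norm A = sqrt (\<Sum>p\<in>{..<n} \<times> {..<n}. (cmod (A $$ p))\<^sup>2)"
  using assms by (simp add: frobenius_norm_def sum.cartesian_product case_prod_beta')

lemma frobenius_norm_nonneg: "frobenius_norm A \<ge> 0"
  by (simp add: frobenius_norm_def sum_nonneg)

lemma norm_entry_le_frobenius_norm:
  assumes "A \<in> carrier_mat n n" "i < n" "j < n"
  shows "cmod (A $$ (i, j)) \<le> frobenius_norm A"
  unfolding frobenius_norm_carrier[OF assms(1)]
  using assms by (intro real_le_rsqrt member_le_sum) auto

text \<open>A minimizing sequence \<open>Y\<close> has bounded entries, so its multiple eigenvalues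
  \<open>z\<close> are bounded too. Along a common subsequence both converge, and the two root
  equations survive in the limit.\<close>

lemma nearest_multiple_eigenvalue_matrix:
  assumes n: "n > 0" and A: "A \<in> carrier_mat n n"
    and ne: "multiple_eigenvalue_matrices n \<noteq> {}"
  shows "\<exists>B\<in>multiple_eigenvalue_matrices n. \<forall>Y\<in>multiple_eigenvalue_matrices n.
    frobenius_norm (A - B) \<le> frobenius_norm (A - Y)"
proof -
  let ?M = "multiple_eigenvalue_matrices n"
  define c where "c = (INF Y\<in>?M. frobenius_norm (A - Y))"
  have bdd: "bdd_below ((\<lambda>Y. frobenius_norm (A - Y)) ` ?M)"
    using frobenius_norm_nonneg by (intro bdd_belowI[of _ 0]) auto
  have "\<exists>Y\<in>?M. frobenius_norm (A - Y) < c + 1 / Suc k" for k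
    using cINF_less_iff[OF ne bdd, of "c + 1 / Suc k"] unfolding c_def by simp
  then obtain Y where YM: "\<And>k. Y k \<in> ?M"
    and Yc: "\<And>k. frobenius_norm (A - Y k) < c + 1 / Suc k"
    by metis
  have Y: "Y k \<in> carrier_mat n n" for k
    using YM unfolding multiple_eigenvalue_matrices_def by blast
  have "\<exists>\<mu>. 2 \<le> Polynomial.order \<mu> (char_poly (Y k))" for k
    using YM multiple_eigenvalue_matrices_iff[OF Y] by blast
  then obtain z where z: "\<And>k. 2 \<le> Polynomial.order (z k) (char_poly (Y k))"
    by metis
  have root: "poly (char_poly (Y k)) (z k) = 0"
    "(\<Sum>i<n. poly (char_poly (mat_delete (Y k) i i)) (z k)) = 0" for k
    using z[of k] multiple_eigenvalue_iff_common_root[OF Y n] by auto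
  have entry: "cmod (Y k $$ (i, j)) \<le> cmod (A $$ (i, j)) + (c + 1)" if "i < n" "j < n" for i j k
  proof -
    have "cmod ((A - Y k) $$ (i, j)) \<le> frobenius_norm (A - Y k)"
      using minus_carrier_mat[OF Y, of A k] that by (intro norm_entry_le_frobenius_norm[of _ n])
    also have "\<dots> \<le> c + 1"
      using Yc[of k] by (rule less_imp_le[THEN order_trans]) (simp add: field_simps)
    finally have "cmod (A $$ (i, j) - Y k $$ (i, j)) \<le> c + 1"
      using A Y[of k] that by simp
    then show ?thesis
      using norm_triangle_ineq2[of "Y k $$ (i, j)" "A $$ (i, j)"]
      by (simp add: norm_minus_commute)
  qed
  have bz: "cmod (z k) \<le> (\<Sum>i<n. \<Sum>j<n. cmod (A $$ (i, j)) + (c + 1))" for k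
  proof -
    have "cmod (z k) \<le> (\<Sum>i<n. \<Sum>j<n. cmod (Y k $$ (i, j)))"
      using root(1)[of k] eigenvalue_root_char_poly[OF Y] by (intro eigenvalue_norm_le[OF Y]) auto
    also have "\<dots> \<le> (\<Sum>i<n. \<Sum>j<n. cmod (A $$ (i, j)) + (c + 1))"
      using entry by (intro sum_mono) auto
    finally show ?thesis .
  qed
  \<comment> \<open>One family holds all sequences that must converge together: index
    \<open>None\<close> is the eigenvalue, \<open>Some q\<close> the matrix entry at
    \<open>q\<close>.\<close>
  define x where "x p = (case p of None \<Rightarrow> z | Some q \<Rightarrow> (\<lambda>k. Y k $$ q))" for p
  have "bounded (range (x p))" if "p \<in> insert None (Some ` ({..<n} \<times> {..<n}))" for p
    using that entry bz unfolding x_def bounded_iff by fastforce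
  then obtain r l where r: "strict_mono r"
    and l: "\<And>p. p \<in> insert None (Some ` ({..<n} \<times> {..<n})) \<Longrightarrow> (\<lambda>k. x p (r k)) \<longlonglongrightarrow> l p"
    using finite_family_convergent_subsequence[of "insert None (Some ` ({..<n} \<times> {..<n}))" x]
    by auto
  define B where "B = mat n n (\<lambda>q. l (Some q))"
  have B: "B \<in> carrier_mat n n"
    unfolding B_def by simp
  have lB: "(\<lambda>k. Y (r k) $$ (i, j)) \<longlonglongrightarrow> B $$ (i, j)" if "i < n" "j < n" for i j
    using l[of "Some (i, j)"] that unfolding x_def B_def by simp
  have lz: "(\<lambda>k. z (r k)) \<longlonglongrightarrow> l None"
    using l[of None] unfolding x_def by simp
  have "(\<lambda>k. poly (char_poly (Y (r k))) (z (r k))) \<longlonglongrightarrow> poly (char_poly B) (l None)"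
    using Y B lB lz by (intro poly_char_poly_tendsto)
  then have "poly (char_poly B) (l None) = 0"
    unfolding root by (simp add: LIMSEQ_const_iff)
  moreover have "(\<lambda>k. \<Sum>i<n. poly (char_poly (mat_delete (Y (r k)) i i)) (z (r k)))
      \<longlonglongrightarrow> (\<Sum>i<n. poly (char_poly (mat_delete B i i)) (l None))"
  proof (intro tendsto_sum poly_char_poly_tendsto[where n = "n - 1"] lz)
    fix i k assume "i \<in> {..<n}"
    show "mat_delete (Y (r k)) i i \<in> carrier_mat (n - 1) (n - 1)"
      "mat_delete B i i \<in> carrier_mat (n - 1) (n - 1)"
      using carrier_matD[OF Y] carrier_matD[OF B] by (auto simp: mat_delete_def intro!: carrier_matI)
  next
    fix i i' j' assume "i \<in> {..<n}" "i' < n - 1" "j' < n - 1"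
    then show "(\<lambda>k. mat_delete (Y (r k)) i i $$ (i', j')) \<longlonglongrightarrow> mat_delete B i i $$ (i', j')"
      using carrier_matD[OF Y] carrier_matD[OF B] unfolding mat_delete_def
      by (auto intro!: lB)
  qed
  then have "(\<Sum>i<n. poly (char_poly (mat_delete B i i)) (l None)) = 0"
    unfolding root by (simp add: LIMSEQ_const_iff)
  ultimately have BM: "B \<in> ?M"
    unfolding multiple_eigenvalue_matrices_iff[OF B] multiple_eigenvalue_iff_common_root[OF B n]
    by blast
  have AY: "A - Y k \<in> carrier_mat n n" and AB: "A - B \<in> carrier_mat n n" for k
    using B Y by (simp_all add: minus_carrier_mat)
  have "(\<lambda>k. frobenius_norm (A - Y (r k))) \<longlonglongrightarrow> frobenius_norm (A - B)"
    unfolding frobenius_norm_carrier[OF AY] frobenius_norm_carrier[OF AB]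
  proof (intro tendsto_real_sqrt tendsto_sum tendsto_power tendsto_norm)
    fix p assume "p \<in> {..<n} \<times> {..<n}"
    then show "(\<lambda>k. (A - Y (r k)) $$ p) \<longlonglongrightarrow> (A - B) $$ p"
      using carrier_matD[OF Y] carrier_matD[OF B] A by (auto intro!: tendsto_intros lB)
  qed
  moreover have "(\<lambda>k. c + 1 / Suc (r k)) \<longlonglongrightarrow> c"
    using tendsto_add[OF tendsto_const[of c] LIMSEQ_subseq_LIMSEQ[OF LIMSEQ_inverse_real_of_nat r]]
    by (simp add: comp_def inverse_eq_divide)
  ultimately have "frobenius_norm (A - B) \<le> c"
    by (rule LIMSEQ_le) (use Yc less_imp_le in blast)
  moreover have "c \<le> frobenius_norm (A - Y)" if "Y \<in> ?M" for Y
    unfolding c_def using bdd that by (rule cINF_lower)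
  ultimately show ?thesis
    using BM by (meson order_trans)
qed

section \<open>Orthogonality at a nearest matrix\<close>

text \<open>First-order condition on a complex line: if the inner product \<open>c\<close> were
  nonzero, a short step along \<open>cnj c\<close> would gain more in the linear term than it costs
  in the quadratic one.\<close>

lemma orthogonal_of_norm_minimal:
  fixes e x :: "'i \<Rightarrow> complex"
  assumes "\<And>s. (\<Sum>i\<in>I. (cmod (e i))\<^sup>2) \<le> (\<Sum>i\<in>I. (cmod (e i - s * x i))\<^sup>2)"
  shows "(\<Sum>i\<in>I. cnj (e i) * x i) = 0"
proof (rule ccontr)
  define c where "c = (\<Sum>i\<in>I. cnj (e i) * x i)"
  define N where "N = (\<Sum>i\<in>I. (cmod (x i))\<^sup>2)"
  \<comment> \<open>With \<open>s = of_real t * cnj c\<close> the gain is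
    \<open>2 * t * (cmod c)\<^sup>2\<close> and the cost is
    \<open>t * (cmod c)\<^sup>2 * (t * N)\<close>; this \<open>t\<close> gives
    \<open>t * N < 1\<close>, and the added 1 covers \<open>N = 0\<close>.\<close>
  define t where "t = 1 / (N + 1)"
  assume "\<not> ?thesis"
  then have c: "(cmod c)\<^sup>2 > 0"
    unfolding c_def by simp
  have N: "N \<ge> 0"
    unfolding N_def by (simp add: sum_nonneg)
  then have t: "t > 0" "t * N < 1"
    unfolding t_def by (auto simp: field_simps)
  have exp: "(cmod (u - v))\<^sup>2 = (cmod u)\<^sup>2 - 2 * Re (cnj u * v) + (cmod v)\<^sup>2" for u v :: complex
    unfolding cmod_power2 by (simp add: power2_eq_square algebra_simps)
  have "(\<Sum>i\<in>I. (cmod (e i - s * x i))\<^sup>2) =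
      (\<Sum>i\<in>I. (cmod (e i))\<^sup>2) - 2 * Re (s * c) + (cmod s)\<^sup>2 * N" for s
    unfolding exp c_def N_def
    by (simp add: sum.distrib sum_subtractf sum_distrib_left norm_mult power_mult_distrib
        mult.left_commute del: times_complex.sel)
  from assms[of "of_real t * cnj c", unfolded this]
  have "2 * Re (of_real t * cnj c * c) \<le> (cmod (of_real t * cnj c))\<^sup>2 * N"
    by simp
  moreover have "of_real t * cnj c * c = of_real (t * (cmod c)\<^sup>2)"
    by (metis complex_norm_square mult.assoc mult.commute of_real_mult)
  then have "Re (of_real t * cnj c * c) = t * (cmod c)\<^sup>2"
    by (metis Re_complex_of_real)
  moreover have "(cmod (of_real t * cnj c))\<^sup>2 * N = t * (cmod c)\<^sup>2 * (t * N)"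
    by (simp add: norm_mult power2_eq_square)
  ultimately have "2 * (t * (cmod c)\<^sup>2) \<le> t * (cmod c)\<^sup>2 * (t * N)"
    by simp
  also have "\<dots> \<le> t * (cmod c)\<^sup>2 * 1"
    using t c by (intro mult_left_mono) auto
  finally show False
    using t c by simp
qed

text \<open>For matrices of equal size this is the trace of the adjoint of \<open>E\<close> times
  \<open>X\<close>, conjugate-linear in \<open>E\<close>.\<close>

definition frobenius_inner :: "complex mat \<Rightarrow> complex mat \<Rightarrow> complex" where
  "frobenius_inner E X = (\<Sum>i<dim_row E. \<Sum>j<dim_col E. cnj (E $$ (i, j)) * X $$ (i, j))"

lemma frobenius_inner_self: "frobenius_inner E E = of_real ((frobenius_norm E)\<^sup>2)"
  by (simp add: frobenius_inner_def frobenius_norm_def sum_nonneg complex_norm_square mult.commute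
      del: of_real_power)

lemma frobenius_inner_nearest_eq_0:
  assumes A: "A \<in> carrier_mat n n" and B: "B \<in> carrier_mat n n" and X: "X \<in> carrier_mat n n"
    and min: "\<And>s. frobenius_norm (A - B) \<le> frobenius_norm (A - (B + s \<cdot>\<^sub>m X))"
  shows "frobenius_inner (A - B) X = 0"
proof -
  let ?I = "{..<n} \<times> {..<n}"
  have "(\<Sum>p\<in>?I. cnj ((A - B) $$ p) * X $$ p) = 0"
  proof (rule orthogonal_of_norm_minimal)
    fix s
    have car: "A - B \<in> carrier_mat n n" "A - (B + s \<cdot>\<^sub>m X) \<in> carrier_mat n n"
      using B X by (simp_all add: minus_carrier_mat)
    have "(A - (B + s \<cdot>\<^sub>m X)) $$ p = (A - B) $$ p - s * X $$ p" if "p \<in> ?I" for p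
      using that A B X by auto
    then show "(\<Sum>p\<in>?I. (cmod ((A - B) $$ p))\<^sup>2) \<le> (\<Sum>p\<in>?I. (cmod ((A - B) $$ p - s * X $$ p))\<^sup>2)"
      using min[of s] unfolding car[THEN frobenius_norm_carrier] by simp
  qed
  then show ?thesis
    unfolding frobenius_inner_def carrier_matD[OF minus_carrier_mat[OF B]]
    by (simp only: sum.cartesian_product case_prod_beta' prod.collapse)
qed

section \<open>Perturbations in the coordinates of a diagonalization\<close>

lemma similar_mat_wit_add:
  assumes B: "B \<in> carrier_mat n n" and wit: "similar_mat_wit B L S T"
    and F: "F \<in> carrier_mat n n"
  shows "similar_mat_wit (B + S * F * T) (L + F) S T"
proof -
  note w = similar_mat_witD2[OF B wit]
  have "B + S * F * T = S * (L + F) * T"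
    using w F by (simp add: mult_add_distrib_mat[of _ n n] add_mult_distrib_mat[of _ n n])
  then show ?thesis
    using w F by (intro similar_mat_witI[of _ _ n]) auto
qed

lemma index_triple_mult_mat:
  fixes S F T :: "'a :: comm_ring_1 mat"
  assumes "S \<in> carrier_mat n n" "F \<in> carrier_mat n n" "T \<in> carrier_mat n n" "r < n" "c < n"
  shows "(S * F * T) $$ (r, c) = (\<Sum>i<n. \<Sum>j<n. F $$ (i, j) * (S $$ (r, i) * T $$ (j, c)))"
proof -
  have "(S * F * T) $$ (r, c) = (\<Sum>j<n. (\<Sum>i<n. S $$ (r, i) * F $$ (i, j)) * T $$ (j, c))"
    using assms by (simp add: scalar_prod_def atLeast0LessThan del: assoc_mult_mat)
  also have "\<dots> = (\<Sum>j<n. \<Sum>i<n. F $$ (i, j) * (S $$ (r, i) * T $$ (j, c)))"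
    by (simp add: sum_distrib_left mult_ac)
  also have "\<dots> = (\<Sum>i<n. \<Sum>j<n. F $$ (i, j) * (S $$ (r, i) * T $$ (j, c)))"
    by (rule sum.swap)
  finally show ?thesis .
qed

text \<open>The matrix of coefficients of the linear form \<open>F \<mapsto> frobenius_inner E (S * F * T)\<close>.\<close>

definition frobenius_pullback :: "complex mat \<Rightarrow> complex mat \<Rightarrow> complex mat \<Rightarrow> nat \<Rightarrow> nat \<Rightarrow> complex" where
  "frobenius_pullback E S T i j =
     (\<Sum>r<dim_row E. \<Sum>c<dim_col E. cnj (E $$ (r, c)) * (S $$ (r, i) * T $$ (j, c)))"

text \<open>Exchanging the sums over the entries of \<open>E\<close> and of \<open>F\<close>
  isolates the coefficient of each \<open>F $$ (i, j)\<close>. Orthogonality to a conjugated matrix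
  unit then says that a single coefficient vanishes.\<close>

lemma frobenius_inner_conj:
  assumes "E \<in> carrier_mat n n" "S \<in> carrier_mat n n" "F \<in> carrier_mat n n" "T \<in> carrier_mat n n"
  shows "frobenius_inner E (S * F * T) = (\<Sum>i<n. \<Sum>j<n. F $$ (i, j) * frobenius_pullback E S T i j)"
proof -
  have square: "(\<Sum>i<n. \<Sum>j<n. G i j) = (\<Sum>p\<in>{..<n} \<times> {..<n}. G (fst p) (snd p))"
    for G :: "nat \<Rightarrow> nat \<Rightarrow> complex"
    by (simp add: sum.cartesian_product case_prod_beta')
  have "frobenius_inner E (S * F * T) = (\<Sum>r<n. \<Sum>c<n. \<Sum>i<n. \<Sum>j<n.
      cnj (E $$ (r, c)) * (F $$ (i, j) * (S $$ (r, i) * T $$ (j, c))))"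
    using assms(1) unfolding frobenius_inner_def
    by (simp add: index_triple_mult_mat[OF assms(2-4)] sum_distrib_left
        del: assoc_mult_mat index_mult_mat)
  also have "\<dots> = (\<Sum>i<n. \<Sum>j<n. \<Sum>r<n. \<Sum>c<n.
      cnj (E $$ (r, c)) * (F $$ (i, j) * (S $$ (r, i) * T $$ (j, c))))"
    unfolding square by (rule sum.swap)
  also have "\<dots> = (\<Sum>i<n. \<Sum>j<n. F $$ (i, j) * frobenius_pullback E S T i j)"
    using assms(1) by (simp add: frobenius_pullback_def sum_distrib_left mult_ac)
  finally show ?thesis .
qed

definition single_entry_mat :: "nat \<Rightarrow> nat \<Rightarrow> nat \<Rightarrow> complex \<Rightarrow> complex mat" where
  "single_entry_mat n i j s = mat n n (\<lambda>(k, l). if k = i \<and> l = j then s else 0)"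

lemma single_entry_mat_carrier [simp]: "single_entry_mat n i j s \<in> carrier_mat n n"
  by (simp add: single_entry_mat_def)

lemma index_single_entry_mat [simp]:
  "k < n \<Longrightarrow> l < n \<Longrightarrow> single_entry_mat n i j s $$ (k, l) = (if k = i \<and> l = j then s else 0)"
  "dim_row (single_entry_mat n i j s) = n" "dim_col (single_entry_mat n i j s) = n"
  by (simp_all add: single_entry_mat_def)

lemma smult_conj_mat:
  fixes S F T :: "'a :: comm_ring_1 mat"
  assumes "S \<in> carrier_mat n n" "F \<in> carrier_mat n n" "T \<in> carrier_mat n n"
  shows "s \<cdot>\<^sub>m (S * F * T) = S * (s \<cdot>\<^sub>m F) * T"
  using assms by (simp add: mult_smult_distrib[of _ n n] mult_smult_assoc_mat[of _ n n])

lemma add_single_entry_triangular: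
  assumes L: "L \<in> carrier_mat n n" "diagonal_mat L" 
  shows "upper_triangular (L + single_entry_mat n i j s) \<or>
    upper_triangular (transpose_mat (L + single_entry_mat n i j s))"
proof (cases "i \<le> j")
  case True
  then have "upper_triangular (L + single_entry_mat n i j s)"
    using L by (auto simp: diagonal_mat_def intro!: upper_triangularI)
  then show ?thesis ..
next
  case False
  then have "upper_triangular (transpose_mat (L + single_entry_mat n i j s))"
    using L by (auto simp: diagonal_mat_def intro!: upper_triangularI)
  then show ?thesis ..
qed

text \<open>The hypotheses keep \<open>L + s \<cdot>\<^sub>m F\<close> triangular with equal entries
  at \<open>a\<close> and \<open>b\<close>, so the whole line through \<open>B\<close> competes with
  \<open>B\<close> in the minimization. \<open>S\<close> and \<open>T\<close> are left variable
  because two diagonalizations of the same \<open>B\<close> will be used.\<close>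

lemma frobenius_pullback_diagonal:
  assumes A: "A \<in> carrier_mat n n" and B: "B \<in> carrier_mat n n"
    and min: "\<And>Y. Y \<in> multiple_eigenvalue_matrices n \<Longrightarrow> frobenius_norm (A - B) \<le> frobenius_norm (A - Y)"
    and wit: "similar_mat_wit B L S T"
    and F: "F \<in> carrier_mat n n"
    and tri: "\<And>s. upper_triangular (L + s \<cdot>\<^sub>m F) \<or> upper_triangular (transpose_mat (L + s \<cdot>\<^sub>m F))"
    and ab: "a < n" "b < n" "a \<noteq> b"
    and eq: "L $$ (a, a) = L $$ (b, b)" "F $$ (a, a) = F $$ (b, b)"
  shows "(\<Sum>i<n. \<Sum>j<n. F $$ (i, j) * frobenius_pullback (A - B) S T i j) = 0"
proof -
  note w = similar_mat_witD2[OF B wit]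
  have "frobenius_inner (A - B) (S * F * T) = 0"
  proof (rule frobenius_inner_nearest_eq_0[OF A B])
    show "S * F * T \<in> carrier_mat n n"
      using w F by auto
    fix s
    have "similar_mat_wit (B + S * (s \<cdot>\<^sub>m F) * T) (L + s \<cdot>\<^sub>m F) S T"
      using similar_mat_wit_add[OF B wit] F by simp
    then have "similar_mat (B + s \<cdot>\<^sub>m (S * F * T)) (L + s \<cdot>\<^sub>m F)"
      unfolding similar_mat_def smult_conj_mat[OF w(6) F w(7)] by blast
    moreover have "(L + s \<cdot>\<^sub>m F) $$ (a, a) = (L + s \<cdot>\<^sub>m F) $$ (b, b)"
      using w F ab eq by simp
    ultimately have "B + s \<cdot>\<^sub>m (S * F * T) \<in> multiple_eigenvalue_matrices n"
      using B w F tri ab by (intro similar_triangular_multiple[of _ n "L + s \<cdot>\<^sub>m F" a b]) auto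
    then show "frobenius_norm (A - B) \<le> frobenius_norm (A - (B + s \<cdot>\<^sub>m (S * F * T)))"
      by (rule min)
  qed
  then show ?thesis
    using frobenius_inner_conj[of "A - B" n S F T] minus_carrier_mat[OF B] w F by simp
qed

lemma sum_single_entry_mat:
  assumes "i < n" "j < n"
  shows "(\<Sum>k<n. \<Sum>l<n. single_entry_mat n i j 1 $$ (k, l) * g k l) = g i j"
proof -
  have "(\<Sum>k<n. \<Sum>l<n. single_entry_mat n i j 1 $$ (k, l) * g k l) =
      (\<Sum>k<n. \<Sum>l<n. if l = j then if k = i then g k l else 0 else 0)"
    by (intro sum.cong refl) simp
  then show ?thesis
    using assms by simp
qed

text \<open>All coefficients of the pulled-back form vanish. Positions off the diagonal, and
  diagonal positions other than \<open>a\<close> and \<open>b\<close>, may be perturbed singly. For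
  the entries at \<open>a\<close> and \<open>b\<close>, moving them together gives their sum, and a
  second diagonalization gives their difference.\<close>

lemma nearest_multiple_eigenvalue_matrix_diagonalizable:
  assumes A: "A \<in> carrier_mat n n" and BM: "B \<in> multiple_eigenvalue_matrices n"
    and min: "\<And>Y. Y \<in> multiple_eigenvalue_matrices n \<Longrightarrow> frobenius_norm (A - B) \<le> frobenius_norm (A - Y)"
    and wit: "similar_mat_wit B L S T" and diag: "diagonal_mat L"
  shows "frobenius_norm (A - B) = 0"
proof -
  have B: "B \<in> carrier_mat n n"
    using BM unfolding multiple_eigenvalue_matrices_def by blast
  note w = similar_mat_witD2[OF B wit]
  obtain a b where ab: "a < n" "b < n" "a \<noteq> b" and eq: "L $$ (a, a) = L $$ (b, b)"
    using similar_diagonal_multiple[OF BM wit diag] by blast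
  let ?g = "frobenius_pullback (A - B)"
  have smult: "s \<cdot>\<^sub>m single_entry_mat n i j 1 = single_entry_mat n i j s" for s i j
    by (intro eq_matI) auto
  \<comment> \<open>An off-diagonal perturbation leaves the diagonal of \<open>L\<close> alone, so
    its equal entries stay equal. This holds for every pair \<open>S'\<close>, \<open>T'\<close>
    that diagonalizes \<open>B\<close> to the same \<open>L\<close>.\<close>
  have offdiag: "?g S' T' i j = 0"
    if wit': "similar_mat_wit B L S' T'" and ij: "i < n" "j < n" "i \<noteq> j" for S' T' i j
  proof -
    have "(\<Sum>k<n. \<Sum>l<n. single_entry_mat n i j 1 $$ (k, l) * ?g S' T' k l) = 0"
      using add_single_entry_triangular[OF w(5) diag] ab ij smult
      by (intro frobenius_pullback_diagonal[OF A B min wit' _ _ ab eq]) auto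
    then show ?thesis
      unfolding sum_single_entry_mat[OF ij(1,2)] .
  qed
  have other: "?g S T i i = 0" if i: "i < n" "i \<noteq> a" "i \<noteq> b" for i
  proof -
    have "(\<Sum>k<n. \<Sum>l<n. single_entry_mat n i i 1 $$ (k, l) * ?g S T k l) = 0"
      using add_single_entry_triangular[OF w(5) diag] ab i smult
      by (intro frobenius_pullback_diagonal[OF A B min wit _ _ ab eq]) auto
    then show ?thesis
      unfolding sum_single_entry_mat[OF i(1,1)] .
  qed
  have add: "?g S T a a + ?g S T b b = 0"
  proof -
    let ?F = "single_entry_mat n a a 1 + single_entry_mat n b b 1"
    have "upper_triangular (L + s \<cdot>\<^sub>m ?F)" for s
      using w(5) diag by (auto simp: diagonal_mat_def)
    then have "(\<Sum>i<n. \<Sum>j<n. ?F $$ (i, j) * ?g S T i j) = 0"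
      using ab by (intro frobenius_pullback_diagonal[OF A B min wit _ _ ab eq]) auto
    moreover have "(\<Sum>i<n. \<Sum>j<n. ?F $$ (i, j) * ?g S T i j) =
        (\<Sum>i<n. \<Sum>j<n. single_entry_mat n a a 1 $$ (i, j) * ?g S T i j) +
        (\<Sum>i<n. \<Sum>j<n. single_entry_mat n b b 1 $$ (i, j) * ?g S T i j)"
      by (simp add: distrib_right sum.distrib del: index_single_entry_mat(1))
    ultimately show ?thesis
      using ab by (simp add: sum_single_entry_mat del: index_single_entry_mat(1))
  qed
  have sub: "?g S T a a - ?g S T b b = 0"
  proof -
    \<comment> \<open>\<open>P = I + E\<^sub>a\<^sub>b\<close> commutes with \<open>L\<close>, so \<open>S * P\<close> diagonalizes \<open>B\<close> as well; the \<open>(b, a)\<close> direction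
      for it has a component along \<open>E\<^sub>a\<^sub>a - E\<^sub>b\<^sub>b\<close>, which is not reached from \<open>S\<close> alone.\<close>
    define P where "P = addrow_mat n (1 :: complex) a b"
    define Q where "Q = addrow_mat n (- 1 :: complex) a b"
    have PQ: "P \<in> carrier_mat n n" "Q \<in> carrier_mat n n" "P * Q = 1\<^sub>m n" "Q * P = 1\<^sub>m n"
      unfolding P_def Q_def using addrow_mat_inv[OF ab, of "1 :: complex"]
        addrow_mat_inv[OF ab, of "- 1 :: complex"] by auto
    have "P * L * Q = addcol (- 1) b a (addrow 1 a b L)"
      unfolding P_def Q_def addrow_mat[OF w(5) ab(2), symmetric]
      using w(5) ab by (intro addcol_mat[symmetric]) auto
    also have "\<dots> = L"
      using w(5) diag ab eq by (intro eq_matI) (auto simp: diagonal_mat_def)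
    finally have "similar_mat_wit L L P Q"
      using PQ w(5) by (intro similar_mat_witI[of _ _ n]) auto
    then have "similar_mat_wit B L (S * P) (Q * T)"
      by (rule similar_mat_wit_trans[OF wit])
    then have "0 = ?g (S * P) (Q * T) b a"
      using ab by (simp add: offdiag)
    also have "S * P = addcol 1 b a S"
      unfolding P_def by (rule addcol_mat[OF w(6) ab(1), symmetric])
    also have "Q * T = addrow (- 1) a b T"
      unfolding Q_def by (rule addrow_mat[OF w(7) ab(2), symmetric])
    \<comment> \<open>Column \<open>b\<close> of the new left factor is the sum of columns
      \<open>a\<close> and \<open>b\<close> of \<open>S\<close>, and row \<open>a\<close> of the new
      right factor is row \<open>a\<close> minus row \<open>b\<close> of \<open>T\<close>.
      Bilinearity gives four terms, of which the two off-diagonal ones are already known to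
      vanish.\<close>
    also have "?g (addcol 1 b a S) (addrow (- 1) a b T) b a =
        ?g S T b a + ?g S T a a - ?g S T b b - ?g S T a b"
      using w(6,7) A B ab unfolding frobenius_pullback_def
      by (simp add: algebra_simps sum.distrib sum_subtractf sum_negf)
    also have "\<dots> = ?g S T a a - ?g S T b b"
      using ab by (simp add: offdiag[OF wit])
    finally show ?thesis ..
  qed
  have g: "?g S T i j = 0" if "i < n" "j < n" for i j
  proof (cases "i = j")
    case True
    have "?g S T a a = 0" "?g S T b b = 0"
      using add sub by (auto simp: add_eq_0_iff2)
    then show ?thesis
      using True other that by metis
  qed (use offdiag[OF wit] that in blast)
  let ?E = "A - B"
  have E: "?E \<in> carrier_mat n n"
    using B by (simp add: minus_carrier_mat)
  \<comment> \<open>Conjugation by \<open>S\<close> is onto: \<open>F = T * ?E * S\<close>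
    represents \<open>?E\<close> itself, so the vanishing coefficients make \<open>?E\<close>
    orthogonal to itself.\<close>
  have "S * (T * ?E * S) * T = (S * T) * ?E * (S * T)"
    using w(6,7) E by (simp add: assoc_mult_mat[of _ n n _ n _ n])
  also have "\<dots> = ?E"
    unfolding w(1) left_mult_one_mat[OF E] right_mult_one_mat[OF E] ..
  finally have conj: "S * (T * ?E * S) * T = ?E" .
  have "T * ?E * S \<in> carrier_mat n n"
    by (rule mult_carrier_mat[OF mult_carrier_mat[OF w(7) E] w(6)])
  from frobenius_inner_conj[OF E w(6) this w(7)]
  have "frobenius_inner ?E ?E = (\<Sum>i<n. \<Sum>j<n. (T * ?E * S) $$ (i, j) * ?g S T i j)"
    unfolding conj .
  also have "\<dots> = 0"
    using g by simp
  finally show ?thesis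
    by (simp add: frobenius_inner_self)
qed

section \<open>Defective matrices near a nondefective one\<close>

text \<open>The entry \<open>s\<close> couples two coordinates with the same eigenvalue, as in a
  Jordan block of size 2. A diagonalization of the perturbed matrix would supply a basis of left
  eigenvectors, but these all vanish at coordinate \<open>a\<close>.\<close>

lemma add_single_entry_defective:
  assumes B: "B \<in> carrier_mat n n" and wit: "similar_mat_wit B L S T" and diag: "diagonal_mat L"
    and ab: "a < n" "b < n" "a \<noteq> b" and eq: "L $$ (a, a) = L $$ (b, b)" and s: "s \<noteq> 0"
  shows "B + S * single_entry_mat n a b s * T \<in> defective_matrices n"
proof -
  let ?Y = "B + S * single_entry_mat n a b s * T" and ?K = "L + single_entry_mat n a b s"
  note w = similar_mat_witD2[OF B wit]
  have Y: "?Y \<in> carrier_mat n n"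
    using B w by auto
  have wY: "similar_mat_wit ?Y ?K S T"
    by (rule similar_mat_wit_add[OF B wit]) simp
  have K: "?K \<in> carrier_mat n n"
    using w by auto
  have "defective ?Y"
  proof (rule ccontr)
    assume "\<not> ?thesis"
    then obtain D U V where "similar_mat_wit ?Y D U V" and D: "diagonal_mat D"
      using nondefective_diagonalizable[OF Y] by blast
    then have "similar_mat_wit ?K D (T * U) (V * S)"
      using similar_mat_wit_trans[OF similar_mat_wit_sym[OF wY]] by blast
    then obtain P Q where "similar_mat_wit ?K D P Q"
      by blast
    note v = similar_mat_witD2[OF K this]
    \<comment> \<open>The resulting equation says that the rows of \<open>Q\<close> are left
      eigenvectors of \<open>?K\<close>.\<close>
    have "Q * (P * D * Q) = (Q * P) * D * Q"
      using v(5-7) by (simp add: assoc_mult_mat[of _ n n _ n _ n])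
    also have "\<dots> = D * Q"
      unfolding v(2) using v(5) by simp
    finally have QK: "Q * ?K = D * Q"
      unfolding v(3)[symmetric] .
    \<comment> \<open>Comparing columns \<open>a\<close> and \<open>b\<close> of \<open>Q * K = D * Q\<close> shows that column \<open>a\<close> of \<open>Q\<close> vanishes.\<close>
    have "Q $$ (i, a) = 0" if i: "i < n" for i
    proof (rule ccontr)
      assume nz: "Q $$ (i, a) \<noteq> 0"
      have col: "(Q * ?K) $$ (i, j) = Q $$ (i, j) * L $$ (j, j) + (if j = b then s * Q $$ (i, a) else 0)"
        if j: "j < n" for j
      proof -
        have "(Q * ?K) $$ (i, j) = (\<Sum>k<n. Q $$ (i, k) * ?K $$ (k, j))"
          using v i j by (simp add: scalar_prod_def atLeast0LessThan)
        also have "\<dots> = (\<Sum>k<n. (if k = j then Q $$ (i, k) * L $$ (k, k) else 0) +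
            (if k = a then (if j = b then s * Q $$ (i, k) else 0) else 0))"
          using w(5) diag j by (intro sum.cong refl) (auto simp: diagonal_mat_def algebra_simps)
        also have "\<dots> = Q $$ (i, j) * L $$ (j, j) + (if j = b then s * Q $$ (i, a) else 0)"
          using j ab by (simp add: sum.distrib)
        finally show ?thesis .
      qed
      have row: "(D * Q) $$ (i, j) = D $$ (i, i) * Q $$ (i, j)" if j: "j < n" for j
      proof -
        have "(D * Q) $$ (i, j) = (\<Sum>k<n. D $$ (i, k) * Q $$ (k, j))"
          using v i j by (simp add: scalar_prod_def atLeast0LessThan)
        also have "\<dots> = (\<Sum>k<n. if k = i then D $$ (i, i) * Q $$ (i, j) else 0)"
          using v(5) D i by (intro sum.cong refl) (auto simp: diagonal_mat_def)
        finally show ?thesis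
          using i by simp
      qed
      \<comment> \<open>Column \<open>a\<close> does not involve \<open>s\<close>, and cancelling
        \<open>Q $$ (i, a)\<close> there identifies the eigenvalue of row \<open>i\<close>. With
        this value, column \<open>b\<close> reduces to \<open>s * Q $$ (i, a) = 0\<close>.\<close>
      have "D $$ (i, i) = L $$ (b, b)"
        using col[OF ab(1)] row[OF ab(1)] QK ab nz eq by auto
      moreover have "Q $$ (i, b) * L $$ (b, b) + s * Q $$ (i, a) = D $$ (i, i) * Q $$ (i, b)"
        using col[OF ab(2)] row[OF ab(2)] QK by simp
      ultimately show False
        using nz s by simp
    qed
    then have "(P * Q) $$ (a, a) = 0"
      using v(5-7) ab by (simp add: scalar_prod_def)
    then show False
      unfolding v(1) using ab by simp
  qed
  with Y show ?thesis
    unfolding defective_matrices_def by blast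
qed

lemma frobenius_norm_smult: "frobenius_norm (s \<cdot>\<^sub>m X) = cmod s * frobenius_norm X"
proof -
  have "(\<Sum>i<dim_row X. \<Sum>j<dim_col X. (cmod ((s \<cdot>\<^sub>m X) $$ (i, j)))\<^sup>2) =
      (cmod s)\<^sup>2 * (\<Sum>i<dim_row X. \<Sum>j<dim_col X. (cmod (X $$ (i, j)))\<^sup>2)"
    by (simp add: sum_distrib_left norm_mult power_mult_distrib)
  then show ?thesis
    by (simp add: frobenius_norm_def real_sqrt_mult)
qed

text \<open>\<open>A\<close> is diagonalizable with a repeated diagonal entry. Any nonzero coupling
  of the two coordinates makes it defective, and the distance to \<open>A\<close> scales with the
  size of the coupling.\<close>

lemma defective_matrices_approximate:
  assumes AM: "A \<in> multiple_eigenvalue_matrices n" and "A \<notin> defective_matrices n" and e: "e > 0"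
  shows "\<exists>Y\<in>defective_matrices n. frobenius_norm (A - Y) < e"
proof -
  have A: "A \<in> carrier_mat n n"
    using AM unfolding multiple_eigenvalue_matrices_def by blast
  then obtain L S T where wit: "similar_mat_wit A L S T" and diag: "diagonal_mat L"
    using nondefective_diagonalizable[OF A] assms unfolding defective_matrices_def by blast
  note w = similar_mat_witD2[OF A wit]
  obtain a b where ab: "a < n" "b < n" "a \<noteq> b" and eq: "L $$ (a, a) = L $$ (b, b)"
    using similar_diagonal_multiple[OF AM wit diag] by blast
  define X where "X = S * single_entry_mat n a b 1 * T"
  \<comment> \<open>The added 1 keeps the denominator positive when \<open>X\<close> has norm 0 and
    makes the distance strictly less than \<open>e\<close>.\<close>
  define t where "t = e / (frobenius_norm X + 1)"
  have t: "t > 0" "t * frobenius_norm X < e"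
    using e frobenius_norm_nonneg[of X] unfolding t_def by (auto simp: field_simps)
  have X: "X \<in> carrier_mat n n"
    using w unfolding X_def by auto
  have "S * single_entry_mat n a b (of_real t) * T = of_real t \<cdot>\<^sub>m X"
  proof -
    have "single_entry_mat n a b (of_real t) = of_real t \<cdot>\<^sub>m single_entry_mat n a b 1"
      by (intro eq_matI) auto
    then show ?thesis
      using w unfolding X_def by (simp add: smult_conj_mat[of _ n])
  qed
  then have "A + of_real t \<cdot>\<^sub>m X \<in> defective_matrices n"
    using add_single_entry_defective[OF A wit diag ab eq, of "of_real t"] t by simp
  moreover have "A - (A + of_real t \<cdot>\<^sub>m X) = (- of_real t) \<cdot>\<^sub>m X"
    using A X by (intro eq_matI) auto
  then have "frobenius_norm (A - (A + of_real t \<cdot>\<^sub>m X)) < e"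
    using t by (simp add: frobenius_norm_smult)
  ultimately show ?thesis
    by blast
qed

section \<open>Existence of a nearest defective matrix\<close>

lemma frobenius_norm_diff_eq_0:
  assumes A: "A \<in> carrier_mat n n" and B: "B \<in> carrier_mat n n" and "frobenius_norm (A - B) = 0"
  shows "A = B"
proof (rule eq_matI)
  fix i j assume ij: "i < dim_row B" "j < dim_col B"
  then have "cmod ((A - B) $$ (i, j)) \<le> 0"
    using norm_entry_le_frobenius_norm[OF minus_carrier_mat[OF B, of A], of i j] assms by simp
  then show "A $$ (i, j) = B $$ (i, j)"
    using ij A B by simp
qed (use A B in auto)

theorem proposition2:
  fixes n :: nat and A :: "complex mat"
  assumes "n \<ge> 2"
    and "A \<in> carrier_mat n n"
  shows "(\<exists>B \<in> defective_matrices n.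
            frobenius_norm (A - B) = (INF Y \<in> defective_matrices n. frobenius_norm (A - Y)))
         \<longleftrightarrow> A \<notin> multiple_eigenvalue_matrices n - defective_matrices n"
proof -
  let ?M = "multiple_eigenvalue_matrices n" and ?D = "defective_matrices n"
  let ?inf = "INF Y \<in> ?D. frobenius_norm (A - Y)"
  note A = assms(2)
  have bdd: "bdd_below ((\<lambda>Y. frobenius_norm (A - Y)) ` ?D)"
    using frobenius_norm_nonneg by (intro bdd_belowI[of _ 0]) auto
  have attained: "\<exists>B\<in>?D. frobenius_norm (A - B) = ?inf"
    if "B \<in> ?D" "\<And>Y. Y \<in> ?D \<Longrightarrow> frobenius_norm (A - B) \<le> frobenius_norm (A - Y)" for B
  proof
    show "frobenius_norm (A - B) = ?inf"
      using that bdd by (intro antisym cINF_greatest cINF_lower) auto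
  qed (rule that)
  show ?thesis
  proof
    assume "\<exists>B\<in>?D. frobenius_norm (A - B) = ?inf"
    then obtain B where BD: "B \<in> ?D" and B: "frobenius_norm (A - B) = ?inf"
      by blast
    show "A \<notin> ?M - ?D"
    proof
      assume AMD: "A \<in> ?M - ?D"
      \<comment> \<open>Defective matrices come arbitrarily close to \<open>A\<close>, so a
        minimizer has distance 0 and equals \<open>A\<close>, which is not defective.\<close>
      have "frobenius_norm (A - B) < e" if "e > 0" for e
      proof -
        obtain Y where "Y \<in> ?D" "frobenius_norm (A - Y) < e"
          using defective_matrices_approximate[of A n e] AMD \<open>e > 0\<close> by blast
        then show ?thesis
          unfolding B using cINF_lower[OF bdd] by (meson le_less_trans)
      qed
      then have "frobenius_norm (A - B) = 0"
        using frobenius_norm_nonneg[of "A - B"] by (metis less_irrefl order_le_less)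
      moreover have "B \<in> carrier_mat n n"
        using BD unfolding defective_matrices_def by blast
      ultimately show False
        using frobenius_norm_diff_eq_0[OF A] BD AMD by blast
    qed
  next
    assume AMD: "A \<notin> ?M - ?D"
    show "\<exists>B\<in>?D. frobenius_norm (A - B) = ?inf"
    proof (cases "A \<in> ?D")
      case True
      have "frobenius_norm (A - A) = 0"
        using A by (simp add: frobenius_norm_def)
      then show ?thesis
        using attained[OF True] frobenius_norm_nonneg by simp
    next
      case False
      \<comment> \<open>The zero matrix shows that \<open>?M\<close> is nonempty: since
        \<open>n \<ge> 2\<close>, positions 0 and 1 exist and carry the same diagonal entry.\<close>
      have "similar_mat (0\<^sub>m n n :: complex mat) (0\<^sub>m n n)"
        by (rule similar_mat_refl[of _ n]) simp
      then have "0\<^sub>m n n \<in> ?M"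
        using assms(1) by (intro similar_triangular_multiple[of _ n "0\<^sub>m n n" 0 1]) auto
      then have ne: "?M \<noteq> {}"
        by blast
      have "0 < n"
        using assms(1) by simp
      then obtain B where BM: "B \<in> ?M"
        and min: "\<And>Y. Y \<in> ?M \<Longrightarrow> frobenius_norm (A - B) \<le> frobenius_norm (A - Y)"
        using nearest_multiple_eigenvalue_matrix[OF _ A ne] by blast
      have B: "B \<in> carrier_mat n n"
        using BM unfolding multiple_eigenvalue_matrices_def by blast
      have "B \<in> ?D"
      proof (rule ccontr)
        assume "B \<notin> ?D"
        then obtain L S T where "similar_mat_wit B L S T" "diagonal_mat L"
          using nondefective_diagonalizable[OF B] B unfolding defective_matrices_def by blast
        then have "frobenius_norm (A - B) = 0"
          using nearest_multiple_eigenvalue_matrix_diagonalizable[OF A BM min] by blast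
        then have "A = B"
          by (rule frobenius_norm_diff_eq_0[OF A B])
        with BM False AMD show False
          by blast
      qed
      \<comment> \<open>\<open>B\<close> minimizes over the larger set \<open>?M\<close> and lies in
        \<open>?D\<close>, hence it also minimizes over \<open>?D\<close>.\<close>
      then show ?thesis
        using attained min defective_matrices_subset by blast
    qed
  qed
qed

end
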